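(* For every integer $\ell \ge 1$, \[ r_\ell = \frac{\ell!}{2} \sum_{k \in \mathbb{Z}} \frac{1}{z_k^{\ell+1}}, \] where $z_k = \log 2 + 2\pi k i$. This can be rewritten in terms of real quantities as \[ r_\ell = \frac{\ell!}{2(\log 2)^{\ell+1}} + \sum_{k \ge 1} \frac{\ell!}{\left((\log 2)^2 + 4\pi^2 k^2\right)^{(\ell+1)/2}}\; T_{\ell+1}\!\left(\frac{\log 2}{\sqrt{(\log 2)^2 + 4\pi^2 k^2}}\right), \] where $T_n(x)$ is the $n$-th Chebyshev polynomial, defined by $\cos(n\theta) = T_n(\cos\theta)$.
   Context: For an integer $\ell\ge 0$ let $[\ell]=\{1,\dots,\ell\}$. A preferential arrangement of $[\ell]$ is a ranking of its elements with ties allowed, i.e. an ordered sequence of pairwise disjoint nonempty subsets (blocks) whose union is $[\ell]$. $r_\ell$ denotes the number of preferential arrangements of $[\ell]$ (with $r_0=1$). Here $\log$ is the natural logarithm and $i$ is the imaginary unit. *)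

theory Defs
  imports "HOL-Analysis.Analysis" "HOL-Library.Disjoint_Sets" "HOL-Computational_Algebra.Polynomial"
begin

text \<open>The disjointness condition is indexed by positions, so a block cannot occur twice.\<close>

definition preferential_arrangement :: "'a set \<Rightarrow> 'a set list \<Rightarrow> bool" where
  "preferential_arrangement A Bs \<longleftrightarrow>
     {} \<notin> set Bs \<and> disjoint_family_on (\<lambda>i. Bs ! i) {..<length Bs} \<and> \<Union>(set Bs) = A"

definition num_pref_arr :: "nat \<Rightarrow> nat" where
  "num_pref_arr l = card {Bs. preferential_arrangement {1..l} Bs}"

lemma preferential_arrangement_distinct:
  assumes "preferential_arrangement A Bs"
  shows "distinct Bs"
proof -
  have "Bs ! i \<noteq> Bs ! j" if "i < length Bs" "j < length Bs" "i \<noteq> j" for i j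
  proof
    assume eq: "Bs ! i = Bs ! j"
    have "Bs ! i \<inter> Bs ! j = {}"
      using assms that unfolding preferential_arrangement_def disjoint_family_on_def by blast
    hence "Bs ! i = {}" using eq by simp
    thus False
      using assms that nth_mem[of i Bs] unfolding preferential_arrangement_def by auto
  qed
  thus ?thesis by (simp add: distinct_conv_nth)
qed

lemma finite_preferential_arrangements:
  assumes "finite A"
  shows "finite {Bs. preferential_arrangement A Bs}"
proof (rule finite_subset)
  show "{Bs. preferential_arrangement A Bs} \<subseteq> {Bs. set Bs \<subseteq> Pow A \<and> distinct Bs}"
    using preferential_arrangement_distinct by (auto simp: preferential_arrangement_def)
  show "finite {Bs. set Bs \<subseteq> Pow A \<and> distinct Bs}"
    using assms by (intro finite_subset_distinct) auto
qed

lemma num_pref_arr_0: "num_pref_arr 0 = 1"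
proof -
  have "{Bs. preferential_arrangement {1..0::nat} Bs} = {[]}"
  proof (intro equalityI subsetI)
    fix Bs :: "nat set list" assume "Bs \<in> {Bs. preferential_arrangement {1..0} Bs}"
    hence "{} \<notin> set Bs" "\<Union>(set Bs) = {}" by (auto simp: preferential_arrangement_def)
    thus "Bs \<in> {[]}" by (cases Bs) auto
  qed (auto simp: preferential_arrangement_def disjoint_family_on_def)
  thus ?thesis by (simp add: num_pref_arr_def)
qed

definition zk :: "int \<Rightarrow> complex" where
  "zk k = complex_of_real (ln 2) + 2 * complex_of_real pi * of_int k * \<i>"

definition chebyshev_poly :: "nat \<Rightarrow> real poly" where
  "chebyshev_poly n = (THE p. \<forall>\<theta>. cos (real n * \<theta>) = poly p (cos \<theta>))"

lemma chebyshev_poly_ex1: "\<exists>!p :: real poly. \<forall>\<theta>. cos (real n * \<theta>) = poly p (cos \<theta>)"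
proof (rule ex_ex1I)
  have "(\<exists>p :: real poly. \<forall>\<theta>. cos (real n * \<theta>) = poly p (cos \<theta>)) \<and>
        (\<exists>p :: real poly. \<forall>\<theta>. cos (real (Suc n) * \<theta>) = poly p (cos \<theta>))"
  proof (induction n)
    case 0
    have "\<forall>\<theta>. cos (real 0 * \<theta>) = poly 1 (cos \<theta>)"
         "\<forall>\<theta>. cos (real (Suc 0) * \<theta>) = poly [:0, 1:] (cos \<theta>)" by simp_all
    thus ?case by blast
  next
    case (Suc n)
    then obtain p q :: "real poly" where p: "\<And>\<theta>. cos (real n * \<theta>) = poly p (cos \<theta>)"
      and q: "\<And>\<theta>. cos (real (Suc n) * \<theta>) = poly q (cos \<theta>)" by blast
    have "cos (real (Suc (Suc n)) * \<theta>) = poly ([:0, 2:] * q - p) (cos \<theta>)" for \<theta>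
    proof -
      have e: "real (Suc (Suc n)) * \<theta> = real (Suc n) * \<theta> + \<theta>"
              "real n * \<theta> = real (Suc n) * \<theta> - \<theta>" by (simp_all add: algebra_simps)
      have "cos (real (Suc (Suc n)) * \<theta>) + cos (real n * \<theta>) = 2 * cos \<theta> * cos (real (Suc n) * \<theta>)"
        unfolding e(1) by (subst e(2), unfold cos_add cos_diff) (simp del: of_nat_Suc)
      thus ?thesis unfolding p q by (simp del: of_nat_Suc)
    qed
    with q show ?case by blast
  qed
  thus "\<exists>p :: real poly. \<forall>\<theta>. cos (real n * \<theta>) = poly p (cos \<theta>)" by blast
next
  fix p q :: "real poly"
  assume "\<forall>\<theta>. cos (real n * \<theta>) = poly p (cos \<theta>)" "\<forall>\<theta>. cos (real n * \<theta>) = poly q (cos \<theta>)"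
  hence z: "poly (p - q) (cos \<theta>) = 0" for \<theta> by simp
  have "{-1..1} \<subseteq> {x. poly (p - q) x = 0}"
  proof
    fix x :: real assume "x \<in> {-1..1}"
    hence "cos (arccos x) = x" by simp
    with z[of "arccos x"] show "x \<in> {x. poly (p - q) x = 0}" by simp
  qed
  moreover have "infinite {-1..1::real}" by (simp add: infinite_Icc)
  ultimately have "infinite {x. poly (p - q) x = 0}" using finite_subset by blast
  thus "p = q" using poly_roots_finite[of "p - q"] by auto
qed

end

theory Submission
  imports Defs "HOL-Complex_Analysis.Cauchy_Integral_Formula"
begin

text \<open>
  Removing the first block of a preferential arrangement of a set of \<open>n > 0\<close> elements leaves a
  preferential arrangement of a proper subset, so the numbers \<open>r\<^sub>n\<close> obey
  \<open>r\<^sub>n = (\<Sum>k<n. (n choose k) * r\<^sub>k)\<close>. The derivatives at \<open>0\<close> of \<open>F x = 1 / (2 - exp x)\<close> obey the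
  same recurrence, by the Leibniz rule applied to \<open>F x * (2 - exp x) = 1\<close>. Hence \<open>r\<^sub>n\<close> is the
  \<open>n\<close>-th derivative of \<open>F\<close> at \<open>0\<close>
  (\<open>card_preferential_arrangements_eq_higher_deriv\<close>).

  The poles of \<open>F\<close> are the points \<open>zk k\<close>, the solutions of \<open>exp x = 2\<close>, and the claimed series is
  the \<open>l\<close>-th derivative of the partial fraction expansion of \<open>F\<close>. No contour integral is needed for
  this expansion: up to an additive constant, a constant factor and the affine change of variable
  \<open>t = (x - ln 2) / (2 * pi * \<i>)\<close>, the function \<open>F\<close> is \<open>pi * cot (pi * t)\<close>, which by the reflection
  formula of the Gamma function equals \<open>Digamma (1 - t) - Digamma t\<close>. The derivatives of the Digamma
  function are the Polygamma functions, up to constant factors the series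
  \<open>\<Sum>k. 1 / (t + k) ^ (n + 1)\<close>; those at \<open>t\<close> and at \<open>1 - t\<close> fit together to one sum over all integers
  (\<open>has_sum_inverse_power_higher_deriv_cot\<close>). Since \<open>l \<ge> 1\<close>, differentiation removes the additive constant, and the
  series converges absolutely.

  For the real form, the terms for \<open>k\<close> and \<open>-k\<close> are complex conjugates, so they add up to twice the
  real part of \<open>1 / z ^ (l + 1)\<close> with \<open>z = zk k\<close>. In polar form this real part is
  \<open>cos ((l + 1) * Arg z) / cmod z ^ (l + 1)\<close>, and \<open>cos (Arg z) = Re z / cmod z\<close> turns the cosine into
  a value of the Chebyshev polynomial.
\<close>

section \<open>Counting preferential arrangements by derivatives\<close>

text \<open>
  Iterated derivatives are computed below by guessing the whole sequence. The set must be open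
  because \<open>deriv\<close> at a point depends on the values nearby.
\<close>
lemma higher_deriv_sequence:
  assumes "open S" and "\<And>n x. x \<in> S \<Longrightarrow> (f n has_field_derivative f (Suc n) x) (at x)"
    and "x \<in> S"
  shows "(deriv ^^ n) (f 0) x = f n x"
  using assms(3)
proof (induction n arbitrary: x)
  case (Suc n)
  have "eventually (\<lambda>y. (deriv ^^ n) (f 0) y = f n y) (nhds x)"
    using eventually_nhds_in_open[OF assms(1) Suc.prems] by eventually_elim (rule Suc.IH)
  hence "deriv ((deriv ^^ n) (f 0)) x = deriv (f n) x"
    by (rule deriv_cong_ev) simp
  also have "\<dots> = f (Suc n) x"
    using assms(2)[OF Suc.prems] by (rule DERIV_imp_deriv)
  finally show ?case by simp
qed simp

lemma preferential_arrangement_Nil: "preferential_arrangement A [] \<longleftrightarrow> A = {}"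
  by (auto simp: preferential_arrangement_def disjoint_family_on_def)

lemma preferential_arrangement_Cons:
  "preferential_arrangement A (B # Bs) \<longleftrightarrow>
     B \<noteq> {} \<and> B \<subseteq> A \<and> preferential_arrangement (A - B) Bs"
proof -
  have dis: "disjoint_family_on (\<lambda>i. (B # Bs) ! i) {..<length (B # Bs)} \<longleftrightarrow>
        B \<inter> \<Union>(set Bs) = {} \<and> disjoint_family_on (\<lambda>i. Bs ! i) {..<length Bs}"
  proof -
    have "disjoint_family_on (\<lambda>i. (B # Bs) ! i) {..<length (B # Bs)} \<longleftrightarrow>
       disjoint_family_on (\<lambda>i. (B # Bs) ! i) (insert 0 (Suc ` {..<length Bs}))"
      by (simp add: lessThan_Suc_eq_insert_0)
    also have "\<dots> \<longleftrightarrow> B \<inter> (\<Union>i<length Bs. Bs ! i) = {} \<and>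
        disjoint_family_on (\<lambda>i. (B # Bs) ! i) (Suc ` {..<length Bs})"
      by (subst disjoint_family_on_insert) auto
    also have "(\<Union>i<length Bs. Bs ! i) = \<Union>(set Bs)"
      by (auto simp: set_conv_nth)
    also have "disjoint_family_on (\<lambda>i. (B # Bs) ! i) (Suc ` {..<length Bs}) \<longleftrightarrow>
        disjoint_family_on (\<lambda>i. Bs ! i) {..<length Bs}"
      by (auto simp: disjoint_family_on_def)
    finally show ?thesis .
  qed
  show ?thesis
    unfolding preferential_arrangement_def dis by auto
qed

text \<open>
  The set \<open>C\<close> that remains after removing the first block determines that block as \<open>A - C\<close>, and the
  block is nonempty exactly when \<open>C \<noteq> A\<close>. Indexing by \<open>C\<close> instead of by the block makes the
  recursion refer to smaller sets directly.
\<close>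
lemma card_preferential_arrangements_rec:
  assumes "finite A" "A \<noteq> {}"
  shows "card {Bs. preferential_arrangement A Bs} =
         (\<Sum>C\<in>Pow A - {A}. card {Bs. preferential_arrangement C Bs})"
proof -
  have "{Bs. preferential_arrangement A Bs} =
        (\<Union>C\<in>Pow A - {A}. (#) (A - C) ` {Bs. preferential_arrangement C Bs})" (is "?L = ?R")
  proof (intro equalityI subsetI)
    fix Bs assume Bs: "Bs \<in> ?L"
    then obtain B Bs' where eq: "Bs = B # Bs'"
      using assms(2) by (cases Bs) (auto simp: preferential_arrangement_Nil)
    have "B \<noteq> {}" "B \<subseteq> A" and rest: "preferential_arrangement (A - B) Bs'"
      using Bs by (auto simp: eq preferential_arrangement_Cons)
    hence "A - B \<in> Pow A - {A}" "B = A - (A - B)" by auto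
    with rest show "Bs \<in> ?R" unfolding eq by blast
  next
    fix Bs assume "Bs \<in> ?R"
    then obtain C Bs' where C: "C \<subseteq> A" "C \<noteq> A" "Bs = (A - C) # Bs'"
      and "preferential_arrangement C Bs'" by blast
    moreover have "A - (A - C) = C" using C by blast
    ultimately show "Bs \<in> ?L" by (auto simp: preferential_arrangement_Cons)
  qed
  also have "card \<dots> = (\<Sum>C\<in>Pow A - {A}. card ((#) (A - C) ` {Bs. preferential_arrangement C Bs}))"
    using assms
    by (intro card_UN_disjoint)
       (auto intro!: finite_imageI finite_preferential_arrangements intro: finite_subset)
  also have "\<dots> = (\<Sum>C\<in>Pow A - {A}. card {Bs. preferential_arrangement C Bs})"
    by (intro sum.cong refl card_image) (auto simp: inj_on_def)
  finally show ?thesis .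
qed

lemma sum_proper_subsets_card:
  fixes g :: "nat \<Rightarrow> 'a :: comm_semiring_1"
  assumes "finite A"
  shows "(\<Sum>C\<in>Pow A - {A}. g (card C)) = (\<Sum>k<card A. of_nat (card A choose k) * g k)"
proof -
  have "(\<Sum>C\<in>Pow A - {A}. g (card C)) =
        (\<Sum>k<card A. of_nat (card {C \<in> Pow A - {A}. card C = k}) * g k)"
    using assms by (intro sum_fun_comp) (auto intro!: psubset_card_mono)
  also have "\<dots> = (\<Sum>k<card A. of_nat (card A choose k) * g k)"
  proof (intro sum.cong refl)
    fix k assume "k \<in> {..<card A}"
    hence "{C \<in> Pow A - {A}. card C = k} = {C. C \<subseteq> A \<and> card C = k}" by auto
    thus "of_nat (card {C \<in> Pow A - {A}. card C = k}) * g k = of_nat (card A choose k) * g k"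
      by (simp add: n_subsets[OF assms])
  qed
  finally show ?thesis .
qed

text \<open>
  In the Leibniz expansion of the \<open>n\<close>-th derivative of \<open>F x * (2 - exp x) = 1\<close> at \<open>0\<close>, the second
  factor contributes \<open>1\<close> when it is not differentiated and \<open>-1\<close> otherwise.
\<close>
lemma higher_deriv_inverse_2_minus_exp_rec:
  fixes F :: "complex \<Rightarrow> complex"
  defines "F \<equiv> (\<lambda>x. 1 / (2 - exp x))"
  assumes "n > 0"
  shows "(deriv ^^ n) F 0 = (\<Sum>k<n. of_nat (n choose k) * (deriv ^^ k) F 0)"
proof -
  let ?E = "\<lambda>x::complex. 2 - exp x"
  define S where "S = {x::complex. exp x \<noteq> 2}"
  have S: "open S" "0 \<in> S"
    unfolding S_def by (auto intro!: open_Collect_neq continuous_intros)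
  have hol: "F holomorphic_on S" "?E holomorphic_on S"
    unfolding F_def S_def by (auto intro!: holomorphic_intros)
  have E: "(deriv ^^ j) ?E 0 = (if j = 0 then 1 else -1)" for j
  proof -
    have "(deriv ^^ j) (\<lambda>x. (if (0::nat) = 0 then 2 else 0) - exp x) 0 =
          (if j = 0 then 2 else 0) - exp (0 :: complex)"
      by (rule higher_deriv_sequence[of UNIV "\<lambda>j x. (if j = 0 then 2 else 0) - exp x"])
         (auto intro!: derivative_eq_intros)
    thus ?thesis by simp
  qed
  have "0 = (deriv ^^ n) (\<lambda>x. 1 :: complex) 0"
    using assms by simp
  also have "\<dots> = (deriv ^^ n) (\<lambda>x. F x * ?E x) 0"
  proof (rule higher_deriv_cong_ev)
    show "eventually (\<lambda>x. 1 = F x * ?E x) (nhds 0)"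
      using eventually_nhds_in_open[OF S]
      by eventually_elim (auto simp: F_def S_def)
  qed simp
  also have "\<dots> = (\<Sum>i\<le>n. of_nat (n choose i) * (deriv ^^ i) F 0 * (deriv ^^ (n - i)) ?E 0)"
    using higher_deriv_mult[OF hol S] by (simp add: atLeast0AtMost)
  also have "\<dots> = (\<Sum>i<n. of_nat (n choose i) * (deriv ^^ i) F 0 * (deriv ^^ (n - i)) ?E 0)
        + (deriv ^^ n) F 0"
    unfolding lessThan_Suc_atMost[symmetric] by (simp add: E)
  also have "(\<Sum>i<n. of_nat (n choose i) * (deriv ^^ i) F 0 * (deriv ^^ (n - i)) ?E 0) =
        - (\<Sum>i<n. of_nat (n choose i) * (deriv ^^ i) F 0)"
    unfolding sum_negf[symmetric] by (intro sum.cong refl) (simp add: E)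
  finally show ?thesis by simp
qed

text \<open>
  Induction over arbitrary finite sets, rather than over \<open>{1..n}\<close>, lets the induction hypothesis
  apply to every proper subset as it stands; that the count depends on the cardinality alone is part
  of the conclusion.
\<close>
theorem card_preferential_arrangements_eq_higher_deriv:
  assumes "finite A"
  shows "of_nat (card {Bs. preferential_arrangement A Bs}) =
         (deriv ^^ card A) (\<lambda>x. 1 / (2 - exp x)) (0 :: complex)"
  using assms
proof (induction A rule: finite_psubset_induct)
  case (psubset A)
  let ?F = "\<lambda>x::complex. 1 / (2 - exp x)"
  show ?case
  proof (cases "A = {}")
    case True
    have "{Bs :: 'a set list. preferential_arrangement {} Bs} = {[]}"
    proof (intro equalityI subsetI)
      fix Bs :: "'a set list" assume "Bs \<in> {Bs. preferential_arrangement {} Bs}"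
      thus "Bs \<in> {[]}" by (cases Bs) (auto simp: preferential_arrangement_Cons)
    qed (simp add: preferential_arrangement_Nil)
    with True show ?thesis by simp
  next
    case False
    have "of_nat (card {Bs. preferential_arrangement A Bs}) =
          (\<Sum>C\<in>Pow A - {A}. of_nat (card {Bs. preferential_arrangement C Bs}) :: complex)"
      by (simp add: card_preferential_arrangements_rec[OF psubset.hyps False])
    also have "\<dots> = (\<Sum>C\<in>Pow A - {A}. (deriv ^^ card C) ?F 0)"
      by (intro sum.cong refl psubset.IH) auto
    also have "\<dots> = (\<Sum>k<card A. of_nat (card A choose k) * (deriv ^^ k) ?F 0)"
      using psubset.hyps by (rule sum_proper_subsets_card)
    also have "\<dots> = (deriv ^^ card A) ?F 0"
      using False psubset.hyps
      by (intro higher_deriv_inverse_2_minus_exp_rec[symmetric]) (simp add: card_gt_0_iff)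
    finally show ?thesis .
  qed
qed

section \<open>The partial fraction expansion of the cotangent and its derivatives\<close>

lemma not_Ints_imp_not_nonpos_Ints:
  fixes z :: "'a :: ring_1"
  assumes "z \<notin> \<int>"
  shows "z \<notin> \<int>\<^sub>\<le>\<^sub>0 \<and> 1 - z \<notin> \<int>\<^sub>\<le>\<^sub>0"
proof
  show "z \<notin> \<int>\<^sub>\<le>\<^sub>0"
    using assms nonpos_Ints_Int by blast
  have "z \<in> \<int>" if "1 - z \<in> \<int>"
    using Ints_diff[OF Ints_1 that] by simp
  thus "1 - z \<notin> \<int>\<^sub>\<le>\<^sub>0"
    using assms nonpos_Ints_Int by blast
qed

lemma sin_pi_mult_nonzero:
  fixes z :: complex
  assumes "z \<notin> \<int>"
  shows "sin (of_real pi * z) \<noteq> 0"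
proof
  assume "sin (of_real pi * z) = 0"
  then obtain n :: int where "of_real pi * z = of_real (n * pi)"
    by (auto simp: sin_eq_0)
  hence "z = of_int n" by (simp add: field_simps)
  thus False using assms by simp
qed

text \<open>
  By the reflection formula, \<open>Gamma w * Gamma (1 - w) * sin (pi * w)\<close> is constant off the integers;
  the identity says that its logarithmic derivative vanishes.
\<close>
lemma cot_pi_eq_Digamma:
  fixes z :: complex
  assumes "z \<notin> \<int>"
  shows "of_real pi * cot (of_real pi * z) = Digamma (1 - z) - Digamma z"
proof -
  let ?s = "\<lambda>w. sin (of_real pi * w) :: complex"
  have s: "?s z \<noteq> 0"
    using assms by (rule sin_pi_mult_nonzero)
  define P where "P = (\<lambda>w::complex. Gamma w * Gamma (1 - w) * ?s w)"
  have Pz: "P w = of_real pi" if "w \<notin> \<int>" for w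
  proof -
    have "?s w \<noteq> 0"
      using sin_pi_mult_nonzero[OF that] by simp
    thus ?thesis using Gamma_reflection_complex[of w] by (simp add: P_def)
  qed
  have "(P has_field_derivative
          (Gamma z * Digamma z * Gamma (1 - z) - Gamma z * (Gamma (1 - z) * Digamma (1 - z))) * ?s z
          + Gamma z * Gamma (1 - z) * (cos (of_real pi * z) * of_real pi)) (at z)"
    unfolding P_def using not_Ints_imp_not_nonpos_Ints[OF assms]
    by (auto intro!: derivative_eq_intros)
  moreover have "(P has_field_derivative 0) (at z)"
  proof (rule DERIV_cong_ev[THEN iffD2, OF refl _ refl])
    show "eventually (\<lambda>w. P w = of_real pi) (nhds z)"
      using eventually_nhds_in_open[OF open_Compl[OF closed_Ints], of z] assms Pz
      by (auto elim!: eventually_mono)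
  qed auto
  ultimately have "(Gamma z * Digamma z * Gamma (1 - z) - Gamma z * (Gamma (1 - z) * Digamma (1 - z))) * ?s z
          + Gamma z * Gamma (1 - z) * (cos (of_real pi * z) * of_real pi) = 0"
    by (rule DERIV_unique)
  hence "Gamma z * Gamma (1 - z) * ((Digamma z - Digamma (1 - z)) * ?s z + of_real pi * cos (of_real pi * z)) = 0"
    by (simp add: algebra_simps)
  moreover have "Gamma z * Gamma (1 - z) \<noteq> 0"
    using not_Ints_imp_not_nonpos_Ints[OF assms] by (simp add: Gamma_eq_zero_iff)
  ultimately have "(Digamma z - Digamma (1 - z)) * ?s z + of_real pi * cos (of_real pi * z) = 0"
    by simp
  thus ?thesis using s by (simp add: cot_def field_simps)
qed

lemma higher_deriv_cot_pi:
  fixes z :: complex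
  assumes "z \<notin> \<int>"
  shows "(deriv ^^ n) (\<lambda>z. of_real pi * cot (of_real pi * z)) z =
         (-1) ^ n * Polygamma n (1 - z) - Polygamma n z"
proof -
  let ?f = "\<lambda>n z. (-1) ^ n * Polygamma n (1 - z) - Polygamma n z :: complex"
  have "(deriv ^^ n) (\<lambda>z. of_real pi * cot (of_real pi * z)) z = (deriv ^^ n) (?f 0) z"
  proof (rule higher_deriv_cong_ev)
    show "eventually (\<lambda>z. of_real pi * cot (of_real pi * z) = ?f 0 z) (nhds z)"
      using eventually_nhds_in_open[OF open_Compl[OF closed_Ints], of z] assms
      by (auto elim!: eventually_mono simp: cot_pi_eq_Digamma)
  qed simp
  also have "\<dots> = ?f n z"
  proof (rule higher_deriv_sequence[of "-\<int>"])
    fix n and z :: complex assume "z \<in> -\<int>"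
    with not_Ints_imp_not_nonpos_Ints[of z] show "(?f n has_field_derivative ?f (Suc n) z) (at z)"
      by (auto intro!: derivative_eq_intros)
  qed (use assms in auto)
  finally show ?thesis .
qed

text \<open>
  Absolute convergence turns the Polygamma series, an ordered limit of partial sums, into an
  unordered sum, which can then be reindexed over the integers.
\<close>
lemma summable_norm_inverse_shifted_power:
  fixes z :: complex
  assumes "n \<ge> 2"
  shows "summable (\<lambda>k. norm (inverse ((z + of_nat k) ^ n)))"
proof (rule summable_comparison_test_ev)
  show "summable (\<lambda>k. 2 ^ n * inverse (real k ^ n))"
    using inverse_power_summable[of n, where 'a = real] assms by (intro summable_mult) simp
  \<comment> \<open>For \<open>k \<ge> 2 * norm z\<close> the term \<open>z + k\<close> has norm at least \<open>k / 2\<close>.\<close>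
  show "eventually (\<lambda>k. norm (norm (inverse ((z + of_nat k) ^ n))) \<le> 2 ^ n * inverse (real k ^ n)) sequentially"
    using eventually_ge_at_top[of "nat \<lceil>2 * norm z\<rceil> + 1"]
  proof eventually_elim
    case (elim k)
    hence k: "real k > 0" "norm z \<le> real k / 2" by linarith+
    have "real k / 2 \<le> norm (of_nat k :: complex) - norm z" using k by simp
    also have "\<dots> \<le> norm (z + of_nat k)" by (metis add.commute norm_diff_ineq)
    finally have "inverse (norm (z + of_nat k) ^ n) \<le> inverse ((real k / 2) ^ n)"
      using k by (intro le_imp_inverse_le power_mono) auto
    also have "\<dots> = 2 ^ n * inverse (real k ^ n)" by (simp add: power_divide divide_simps)
    finally show ?case by (simp add: norm_inverse norm_power)
  qed
qed

lemma has_sum_int_split: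
  fixes f :: "int \<Rightarrow> 'a :: topological_comm_monoid_add"
  assumes "((\<lambda>n::nat. f (int n)) has_sum a) UNIV" "((\<lambda>n::nat. f (- 1 - int n)) has_sum b) UNIV"
  shows "(f has_sum (a + b)) UNIV"
proof -
  have "(f has_sum a) {0..}"
    using assms(1)
    by (rule has_sum_reindex_bij_witness[of _ nat int, THEN iffD1, rotated -1]) auto
  moreover have "(f has_sum b) {..<0}"
    using assms(2)
    by (rule has_sum_reindex_bij_witness[of _ "\<lambda>k. nat (- 1 - k)" "\<lambda>n. - 1 - int n", THEN iffD1, rotated -1]) auto
  ultimately have "(f has_sum (a + b)) ({0..} \<union> {..<0})"
    by (rule has_sum_Un_disjoint) auto
  moreover have "{0..} \<union> {..<0} = (UNIV :: int set)" by auto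
  ultimately show ?thesis by simp
qed

text \<open>
  The derivatives of \<open>pi * cot (pi * z) = 1 / z + (\<Sum>k\<ge>1. 1 / (z + k) + 1 / (z - k))\<close>, taken term by
  term. The Polygamma function at \<open>z\<close> supplies the terms with \<open>k \<ge> 0\<close> and the one at \<open>1 - z\<close> those
  with \<open>k < 0\<close>.
\<close>
lemma has_sum_inverse_power_higher_deriv_cot:
  fixes z :: complex
  assumes "z \<notin> \<int>" "n > 0"
  shows "((\<lambda>k::int. 1 / (z + of_int k) ^ Suc n) has_sum
           ((-1) ^ n / fact n * (deriv ^^ n) (\<lambda>z. of_real pi * cot (of_real pi * z)) z)) UNIV"
proof -
  let ?g = "\<lambda>w::complex. (-1) ^ Suc n * Polygamma n w / fact n"
  have *: "((\<lambda>k::nat. inverse ((w + of_nat k) ^ Suc n)) has_sum ?g w) UNIV" if "w \<noteq> 0" for w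
    using that assms
    by (intro norm_summable_imp_has_sum summable_norm_inverse_shifted_power Polygamma_LIMSEQ) auto
  have nz: "z \<noteq> 0" "1 - z \<noteq> 0" using assms by auto
  have "((\<lambda>k::int. 1 / (z + of_int k) ^ Suc n) has_sum (?g z + (-1) ^ Suc n * ?g (1 - z))) UNIV"
  proof (rule has_sum_int_split)
    show "((\<lambda>k::nat. 1 / (z + of_int (int k)) ^ Suc n) has_sum ?g z) UNIV"
      using *[OF nz(1)] by (simp add: inverse_eq_divide)
    have "1 / (z + of_int (- 1 - int k)) ^ Suc n = (-1) ^ Suc n * inverse ((1 - z + of_nat k) ^ Suc n)" for k
    proof -
      have "z + of_int (- 1 - int k) = - (1 - z + of_nat k)" by simp
      hence "(z + of_int (- 1 - int k)) ^ Suc n = (-1) ^ Suc n * (1 - z + of_nat k) ^ Suc n"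
        by (metis power_minus)
      thus ?thesis by (simp add: divide_inverse flip: power_inverse)
    qed
    thus "((\<lambda>k::nat. 1 / (z + of_int (- 1 - int k)) ^ Suc n) has_sum (-1) ^ Suc n * ?g (1 - z)) UNIV"
      using has_sum_cmult_right[OF *[OF nz(2)], of "(-1) ^ Suc n"] by presburger
  qed
  also have "?g z + (-1) ^ Suc n * ?g (1 - z) =
     (-1) ^ n / fact n * (deriv ^^ n) (\<lambda>z. of_real pi * cot (of_real pi * z)) z"
    unfolding higher_deriv_cot_pi[OF assms(1)]
    by (simp add: field_simps flip: power_add)
  finally show ?thesis .
qed

section \<open>The series over the poles\<close>

text \<open>
  The integers, where the cotangent has its poles, correspond under the change of variable to
  poles of \<open>1 / (2 - exp x)\<close>.
\<close>
lemma exp_scaled_int_imp: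
  fixes x :: complex
  assumes "(x - of_real (ln 2)) / (2 * of_real pi * \<i>) \<in> \<int>"
  shows "exp x = 2"
proof -
  obtain n :: int where "(x - of_real (ln 2)) / (2 * of_real pi * \<i>) = of_int n"
    using assms by (auto elim: Ints_cases)
  hence "x = of_real (ln 2) + 2 * of_int n * of_real pi * \<i>"
    by (simp add: field_simps)
  hence "exp x = exp (of_real (ln 2)) * exp (2 * of_int n * of_real pi * \<i>)"
    by (simp add: exp_add)
  also have "exp (2 * of_int n * of_real pi * \<i>) = 1"
    using exp_integer_2pi[of "of_int n"] by (simp add: mult_ac)
  also have "exp (of_real (ln 2) :: complex) = 2"
    by (simp add: exp_of_real)
  finally show ?thesis by simp
qed

text \<open>
  With \<open>h = (x - ln 2) / 2\<close> one has \<open>2 - exp x = 2 * (1 - exp (2 * h))\<close>, and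
  \<open>1 / (1 - exp (2 * h)) = (1 - coth h) / 2\<close>; the hyperbolic cotangent is a cotangent of an imaginary
  argument.
\<close>
lemma inverse_2_minus_exp_eq_cot:
  fixes x :: complex
  assumes "exp x \<noteq> 2"
  shows "1 / (2 - exp x) = 1 / 4 + \<i> / 4 *
           cot (of_real pi * ((x - of_real (ln 2)) / (2 * of_real pi * \<i>)))"
proof -
  define a where "a = exp ((x - of_real (ln 2)) / 2)"
  define w where "w = of_real pi * ((x - of_real (ln 2)) / (2 * of_real pi * \<i>))"
  have iw: "\<i> * w = (x - of_real (ln 2)) / 2"
    by (simp add: w_def field_simps)
  have a0: "a \<noteq> 0" by (simp add: a_def)
  have e2: "exp (of_real (ln 2) :: complex) = 2"
    by (simp add: exp_of_real)
  have a2: "a\<^sup>2 = exp x / 2"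
  proof -
    have "a\<^sup>2 = exp (x - of_real (ln 2))"
      by (simp add: a_def power2_eq_square flip: exp_add)
    thus ?thesis by (simp add: exp_diff e2)
  qed
  have a1: "a\<^sup>2 \<noteq> 1"
    using assms by (simp add: a2)
  have "cot w = ((a + 1 / a) / 2) / ((a - 1 / a) / (2 * \<i>))"
    unfolding cot_def sin_exp_eq cos_exp_eq exp_minus iw a_def[symmetric] inverse_eq_divide
    by (rule refl)
  also have "a + 1 / a = (a\<^sup>2 + 1) / a"
    using a0 by (simp add: add_divide_distrib power2_eq_square)
  also have "a - 1 / a = (a\<^sup>2 - 1) / a"
    using a0 by (simp add: diff_divide_distrib power2_eq_square)
  finally have cot: "cot w = (((a\<^sup>2 + 1) / a) / 2) / (((a\<^sup>2 - 1) / a) / (2 * \<i>))" .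
  \<comment> \<open>In terms of \<open>d\<close> the remaining claims are identities of fractions with denominators \<open>d\<close>.\<close>
  define d where "d = a\<^sup>2 - 1"
  have d: "a\<^sup>2 + 1 = d + 2" "d \<noteq> 0" "2 - exp x = - 2 * d"
    using a1 by (simp_all add: d_def a2)
  have s: "\<i> / 4 * cot w = - (d + 2) / (4 * d)"
    unfolding cot d(1) d_def[symmetric] using a0 d(2) by (simp add: field_simps)
  have "1 / (2 - exp x) = 1 / 4 + \<i> / 4 * cot w"
    unfolding s d(3) using d(2) by (simp add: field_simps)
  thus ?thesis unfolding w_def .
qed

text \<open>
  The points \<open>x\<close> and \<open>u * x + t\<close> correspond under the change of variable above, which contributes a
  factor \<open>u\<close> per derivative. The remaining \<open>- u / 2\<close> is the constant \<open>\<i> / (4 * pi)\<close> in front of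
  \<open>pi * cot (pi * t)\<close>.
\<close>
lemma higher_deriv_inverse_2_minus_exp_eq_cot:
  fixes u t :: complex
  defines "u \<equiv> 1 / (2 * of_real pi * \<i>)"
  defines "t \<equiv> - of_real (ln 2) * u"
  assumes "n > 0"
  shows "(deriv ^^ n) (\<lambda>x. 1 / (2 - exp x)) 0 =
           - (u ^ Suc n / 2) * (deriv ^^ n) (\<lambda>z. of_real pi * cot (of_real pi * z)) t"
proof -
  let ?c = "\<lambda>z::complex. of_real pi * cot (of_real pi * z)"
  define S where "S = {x::complex. exp x \<noteq> 2}"
  have S: "open S" "0 \<in> S"
    unfolding S_def by (auto intro!: open_Collect_neq continuous_intros)
  have T: "u * x + t \<in> - \<int>" if "x \<in> S" for x
    using that exp_scaled_int_imp[of x] by (auto simp: S_def u_def t_def diff_divide_distrib)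
  have hol: "?c holomorphic_on - \<int>"
    unfolding cot_def using sin_pi_mult_nonzero by (auto intro!: holomorphic_intros)
  have hol': "(\<lambda>x. ?c (u * x + t)) holomorphic_on S"
    by (rule holomorphic_on_compose_gen[OF _ hol, unfolded o_def])
       (use T in \<open>auto intro!: holomorphic_intros\<close>)
  have "(deriv ^^ n) (\<lambda>x. 1 / (2 - exp x)) 0 = (deriv ^^ n) (\<lambda>x. 1 / 4 + - (u / 2) * ?c (u * x + t)) 0"
  proof (rule higher_deriv_cong_ev)
    have "1 / (2 - exp x) = 1 / 4 + - (u / 2) * ?c (u * x + t)" if "x \<in> S" for x
    proof -
      have "u * x + t = (x - of_real (ln 2)) / (2 * of_real pi * \<i>)"
        by (simp add: u_def t_def diff_divide_distrib)
      hence "1 / (2 - exp x) = 1 / 4 + \<i> / 4 * cot (of_real pi * (u * x + t))"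
        using inverse_2_minus_exp_eq_cot[of x] that by (simp only: S_def mem_Collect_eq not_False_eq_True)
      also have "\<i> / 4 = - (u / 2) * of_real pi"
        by (simp add: u_def field_simps)
      finally show ?thesis by (simp only: mult.assoc)
    qed
    thus "eventually (\<lambda>x. 1 / (2 - exp x) = 1 / 4 + - (u / 2) * ?c (u * x + t)) (nhds 0)"
      using eventually_nhds_in_open[OF S] by (auto elim!: eventually_mono)
  qed simp
  also have "\<dots> = (deriv ^^ n) (\<lambda>x. - (u / 2) * ?c (u * x + t)) 0"
    using assms(3) S hol'
    by (subst higher_deriv_add[of _ S]) (auto intro!: holomorphic_intros)
  also have "\<dots> = - (u / 2) * (deriv ^^ n) (\<lambda>x. ?c (u * x + t)) 0"
    using hol' S by (intro higher_deriv_cmult)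
  also have "(deriv ^^ n) (\<lambda>x. ?c (u * x + t)) 0 = u ^ n * (deriv ^^ n) ?c (u * 0 + t)"
    by (rule higher_deriv_compose_linear'[of _ "- \<int>" S]) (use hol S T in auto)
  finally show ?thesis by simp
qed

text \<open>
  The expansion at the parameter \<open>t\<close> of \<open>x = 0\<close>: there \<open>t + k\<close> is a constant multiple of
  \<open>zk (- k)\<close>, so the integers translate into the poles in reverse order.
\<close>
theorem has_sum_inverse_zk_power:
  assumes "l > 0"
  shows "((\<lambda>k::int. 1 / zk k ^ Suc l) has_sum (2 * of_nat (num_pref_arr l) / fact l)) UNIV"
proof -
  define u :: complex where "u = 1 / (2 * of_real pi * \<i>)"
  define t where "t = - of_real (ln 2) * u"
  define D where "D = (deriv ^^ l) (\<lambda>z. of_real pi * cot (of_real pi * z)) t"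
  have u0: "u \<noteq> 0" by (simp add: u_def)
  have t: "t \<notin> \<int>"
    using exp_scaled_int_imp[of 0] by (auto simp: t_def u_def)
  have r: "of_nat (num_pref_arr l) = - (u ^ Suc l / 2) * D"
    unfolding num_pref_arr_def card_preferential_arrangements_eq_higher_deriv[OF finite_atLeastAtMost]
    using higher_deriv_inverse_2_minus_exp_eq_cot[OF assms] by (simp add: D_def t_def u_def)
  have zk: "zk (- k) * (- u) = t + of_int k" for k
    by (simp add: zk_def t_def u_def field_simps)
  have "((\<lambda>k. (- u) ^ Suc l * (1 / (t + of_int k) ^ Suc l)) has_sum
          ((- u) ^ Suc l * ((-1) ^ l / fact l * D))) UNIV"
    unfolding D_def by (intro has_sum_cmult_right has_sum_inverse_power_higher_deriv_cot t assms)
  also have "(\<lambda>k. (- u) ^ Suc l * (1 / (t + of_int k) ^ Suc l)) = (\<lambda>k. 1 / zk (- k) ^ Suc l)"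
    unfolding zk[symmetric] power_mult_distrib using u0 by (simp add: fun_eq_iff)
  also have "(- u) ^ Suc l * ((-1) ^ l / fact l * D) = 2 * of_nat (num_pref_arr l) / fact l"
    unfolding r power_minus[of u] by (simp flip: power_add)
  finally have "((\<lambda>k. 1 / zk (- k) ^ Suc l) has_sum (2 * of_nat (num_pref_arr l) / fact l)) UNIV" .
  thus ?thesis
    by (subst has_sum_reindex_bij_betw[of uminus UNIV UNIV, symmetric])
       (auto intro!: bij_uminus)
qed

section \<open>The real form\<close>

lemma has_sum_even_int:
  fixes g :: "int \<Rightarrow> real"
  assumes "(g has_sum s) UNIV" and even: "\<And>k. g (- k) = g k"
  shows "((\<lambda>n::nat. g (int n)) has_sum ((s - g 0) / 2)) {1..}"
proof -
  have "g summable_on {1..}"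
    using assms(1) by (meson has_sum_imp_summable subset_UNIV summable_on_subset_banach)
  then obtain a where a: "(g has_sum a) {1..}"
    by (auto simp: summable_on_def)
  have neg: "(g has_sum a) {..- 1}"
    using a by (rule has_sum_reindex_bij_witness[of _ uminus uminus, THEN iffD1, rotated -1]) (auto simp: even)
  have "(g has_sum (g 0 + (a + a))) ({0} \<union> ({1..} \<union> {..- 1}))"
    by (intro has_sum_Un_disjoint a neg) (auto intro: has_sum_finiteI)
  also have "{0} \<union> ({1..} \<union> {..- 1}) = (UNIV :: int set)" by auto
  finally have "a = (s - g 0) / 2"
    using has_sum_unique[OF assms(1)] by fastforce
  with a have "(g has_sum ((s - g 0) / 2)) {1..}" by simp
  thus ?thesis
    by (rule has_sum_reindex_bij_witness[of _ int nat, THEN iffD1, rotated -1]) auto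
qed

lemma poly_chebyshev_poly_cos: "poly (chebyshev_poly n) (cos \<theta>) = cos (real n * \<theta>)"
  unfolding chebyshev_poly_def by (rule theI'[OF chebyshev_poly_ex1, THEN spec, symmetric])

text \<open>
  De Moivre's formula gives the real part as \<open>cos (n * Arg z)\<close> over \<open>cmod z ^ n\<close>; inversion only
  changes the sign of the angle, which the cosine ignores.
\<close>
lemma Re_inverse_power_eq_chebyshev:
  assumes "z \<noteq> 0"
  shows "Re (1 / z ^ n) = poly (chebyshev_poly n) (Re z / cmod z) / cmod z ^ n"
proof -
  have z: "z = rcis (cmod z) (Arg z)" by (simp add: rcis_cmod_Arg)
  have "Re z = cmod z * cos (Arg z)"
    using arg_cong[OF z, of Re] unfolding Re_rcis .
  hence c: "Re z / cmod z = cos (Arg z)"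
    using assms by simp
  have "1 / z ^ n = inverse (rcis (cmod z ^ n) (real n * Arg z))"
    unfolding DeMoivre2[symmetric] z[symmetric] by (simp add: inverse_eq_divide)
  hence "Re (1 / z ^ n) = cos (real n * Arg z) / cmod z ^ n"
    by (simp add: rcis_inverse)
  thus ?thesis by (simp add: c poly_chebyshev_poly_cos)
qed

lemma Re_zk: "Re (zk k) = ln 2" and Im_zk: "Im (zk k) = 2 * pi * of_int k"
  by (simp_all add: zk_def)

lemma zk_nonzero: "zk k \<noteq> 0"
  using Re_zk[of k] by auto

lemma cmod_zk: "cmod (zk k) = sqrt ((ln 2)\<^sup>2 + 4 * pi\<^sup>2 * (of_int k)\<^sup>2)"
  by (simp add: cmod_def Re_zk Im_zk power_mult_distrib)

lemma zk_minus: "zk (- k) = cnj (zk k)"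
  by (simp add: complex_eq_iff Re_zk Im_zk)

lemma powr_half_Suc:
  fixes x :: real
  assumes "x \<ge> 0"
  shows "x powr ((real n + 1) / 2) = sqrt x ^ (n + 1)"
proof -
  have "x powr ((real n + 1) / 2) = x powr (1 / 2 * real (n + 1))"
    by (simp add: add.commute)
  also have "\<dots> = (x powr (1 / 2)) powr real (n + 1)"
    by (rule powr_powr[symmetric])
  also have "\<dots> = sqrt x powr real (n + 1)"
    using assms by (simp only: powr_half_sqrt)
  also have "\<dots> = sqrt x ^ (n + 1)"
    using assms by (intro powr_realpow') auto
  finally show ?thesis .
qed

theorem theorem5p2:
  fixes l :: nat
  assumes "l \<ge> 1"
  shows "((\<lambda>k::int. 1 / zk k ^ (l + 1)) summable_on UNIV) \<and>
    (of_nat (num_pref_arr l) = fact l / 2 * (\<Sum>\<^sub>\<infinity>k::int. 1 / zk k ^ (l + 1))) \<and>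
    ((\<lambda>k::nat. fact l / ((ln 2)\<^sup>2 + 4 * pi\<^sup>2 * (real k)\<^sup>2) powr ((real l + 1) / 2)
            * poly (chebyshev_poly (l + 1)) (ln 2 / sqrt ((ln 2)\<^sup>2 + 4 * pi\<^sup>2 * (real k)\<^sup>2)))
          summable_on {1..}) \<and>
    (real (num_pref_arr l) =
           fact l / (2 * ln 2 ^ (l + 1)) +
           (\<Sum>\<^sub>\<infinity>k\<in>{1::nat..}. fact l / ((ln 2)\<^sup>2 + 4 * pi\<^sup>2 * (real k)\<^sup>2) powr ((real l + 1) / 2)
              * poly (chebyshev_poly (l + 1)) (ln 2 / sqrt ((ln 2)\<^sup>2 + 4 * pi\<^sup>2 * (real k)\<^sup>2))))"
proof -
  let ?r = "num_pref_arr l"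
  let ?f = "\<lambda>k::int. 1 / zk k ^ (l + 1)"
  let ?T = "\<lambda>k::nat. fact l / ((ln 2)\<^sup>2 + 4 * pi\<^sup>2 * (real k)\<^sup>2) powr ((real l + 1) / 2)
              * poly (chebyshev_poly (l + 1)) (ln 2 / sqrt ((ln 2)\<^sup>2 + 4 * pi\<^sup>2 * (real k)\<^sup>2))"
  have sum: "(?f has_sum (2 * of_nat ?r / fact l)) UNIV"
    using has_sum_inverse_zk_power[of l] assms by simp
  \<comment> \<open>The sum is real, so it is the sum of the real parts, and these are even in \<open>k\<close>.\<close>
  have "((\<lambda>k. Re (?f k)) has_sum Re (2 * of_nat ?r / fact l)) UNIV"
    using sum by (rule has_sum_Re)
  also have "(2 * of_nat ?r / fact l :: complex) = of_real (2 * real ?r / fact l)"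
    by simp
  finally have "((\<lambda>k. Re (?f k)) has_sum (2 * real ?r / fact l)) UNIV"
    by (simp only: Re_complex_of_real)
  hence "((\<lambda>n::nat. Re (?f (int n))) has_sum ((2 * real ?r / fact l - Re (?f 0)) / 2)) {1..}"
  proof (rule has_sum_even_int)
    fix k
    have "?f (- k) = cnj (?f k)" by (simp add: zk_minus)
    thus "Re (?f (- k)) = Re (?f k)" by (simp only: cnj.simps(1))
  qed
  hence "((\<lambda>n::nat. fact l * Re (?f (int n))) has_sum
           (fact l * ((2 * real ?r / fact l - Re (?f 0)) / 2))) {1..}"
    by (rule has_sum_cmult_right)
  also have "(\<lambda>n::nat. fact l * Re (?f (int n))) = ?T"
  proof
    fix k :: nat
    show "fact l * Re (?f (int k)) = ?T k"
      unfolding Re_inverse_power_eq_chebyshev[OF zk_nonzero]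
      by (simp add: powr_half_Suc cmod_zk Re_zk)
  qed
  also have "Re (?f 0) = 1 / ln 2 ^ (l + 1)"
  proof -
    have "?f 0 = of_real (1 / ln 2 ^ (l + 1))" by (simp add: zk_def)
    thus ?thesis by (simp only: Re_complex_of_real)
  qed
  also have "fact l * ((2 * real ?r / fact l - 1 / ln 2 ^ (l + 1)) / 2) =
               real ?r - fact l / (2 * ln 2 ^ (l + 1))"
    by (simp add: field_simps)
  finally have T: "(?T has_sum (real ?r - fact l / (2 * ln 2 ^ (l + 1)))) {1..}" .
  have "?f summable_on UNIV" "of_nat ?r = fact l / 2 * (\<Sum>\<^sub>\<infinity>k. ?f k)"
    using sum by (auto simp: summable_on_def infsumI)
  moreover have "?T summable_on {1..}"
    using T by (auto simp: summable_on_def)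
  moreover have "real ?r = fact l / (2 * ln 2 ^ (l + 1)) + (\<Sum>\<^sub>\<infinity>k\<in>{1..}. ?T k)"
    using T by (simp add: infsumI)
  ultimately show ?thesis by blast
qed

end
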